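(* Let $r$ be an odd positive integer and let $G$ be an $r$-regular, nonbipartite, connected graph. Then $G$ has a spanning even tree, i.e., a spanning tree $T$ of $G$ in which every pair of leaves is joined by a path of even length.
   Context: All graphs are finite and contain no loops. A tree is called even if every pair of its vertices of degree one (leaves) is joined in the tree by a path of even length. A spanning tree of $G$ is a subgraph that is a tree with vertex set $V(G)$. *)

theory Defs
  imports Main
begin

text \<open>
  Undirected graphs in which parallel edges are allowed and loops are not: edges are
  named objects, and \<open>ends\<close> maps each edge to the set of its two endpoints. Values of
  \<open>ends\<close> outside \<open>edges\<close> are irrelevant.
\<close>

record ('v, 'e) multigraph =
  vertices :: "'v set"
  edges :: "'e set"
  ends :: "'e \<Rightarrow> 'v set"

definition loopless_graph :: "('v, 'e) multigraph \<Rightarrow> bool" where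
  "loopless_graph G \<longleftrightarrow>
     finite (vertices G) \<and> finite (edges G) \<and>
     (\<forall>e\<in>edges G. ends G e \<subseteq> vertices G \<and> card (ends G e) = 2)"

definition vertex_degree :: "('v, 'e) multigraph \<Rightarrow> 'v \<Rightarrow> nat" where
  "vertex_degree G v = card {e \<in> edges G. v \<in> ends G e}"

definition regular_graph :: "nat \<Rightarrow> ('v, 'e) multigraph \<Rightarrow> bool" where
  "regular_graph r G \<longleftrightarrow> (\<forall>v\<in>vertices G. vertex_degree G v = r)"

definition bipartite_graph :: "('v, 'e) multigraph \<Rightarrow> bool" where
  "bipartite_graph G \<longleftrightarrow>
     (\<exists>A B. A \<union> B = vertices G \<and> A \<inter> B = {} \<and>
            (\<forall>e\<in>edges G. \<exists>a\<in>A. \<exists>b\<in>B. ends G e = {a, b}))"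

text \<open>
  A walk is given by its vertices \<open>vs\<close> and its edges \<open>es\<close>, both in order of traversal;
  its length is \<open>length es\<close>.
\<close>

definition is_walk :: "('v, 'e) multigraph \<Rightarrow> 'v list \<Rightarrow> 'e list \<Rightarrow> bool" where
  "is_walk G vs es \<longleftrightarrow>
     length vs = length es + 1 \<and> set vs \<subseteq> vertices G \<and> set es \<subseteq> edges G \<and>
     (\<forall>i<length es. ends G (es ! i) = {vs ! i, vs ! Suc i})"

definition is_path_between ::
    "('v, 'e) multigraph \<Rightarrow> 'v \<Rightarrow> 'v list \<Rightarrow> 'e list \<Rightarrow> 'v \<Rightarrow> bool" where
  "is_path_between G u vs es v \<longleftrightarrow>
     is_walk G vs es \<and> distinct vs \<and> hd vs = u \<and> last vs = v"

text \<open>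
  Distinctness of \<open>es\<close> is needed so that traversing one edge back and forth is not a
  cycle, whereas two parallel edges do form a cycle of length two.
\<close>

definition is_cycle :: "('v, 'e) multigraph \<Rightarrow> 'v list \<Rightarrow> 'e list \<Rightarrow> bool" where
  "is_cycle G vs es \<longleftrightarrow>
     is_walk G vs es \<and> es \<noteq> [] \<and> hd vs = last vs \<and> distinct (tl vs) \<and> distinct es"

definition connected_graph :: "('v, 'e) multigraph \<Rightarrow> bool" where
  "connected_graph G \<longleftrightarrow>
     vertices G \<noteq> {} \<and>
     (\<forall>u\<in>vertices G. \<forall>v\<in>vertices G. \<exists>vs es. is_path_between G u vs es v)"

definition is_tree :: "('v, 'e) multigraph \<Rightarrow> bool" where
  "is_tree T \<longleftrightarrow>
     loopless_graph T \<and> connected_graph T \<and> (\<nexists>vs es. is_cycle T vs es)"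

definition is_subgraph :: "('v, 'e) multigraph \<Rightarrow> ('v, 'e) multigraph \<Rightarrow> bool" where
  "is_subgraph H G \<longleftrightarrow>
     loopless_graph H \<and> vertices H \<subseteq> vertices G \<and> edges H \<subseteq> edges G \<and>
     (\<forall>e\<in>edges H. ends H e = ends G e)"

definition is_spanning_tree :: "('v, 'e) multigraph \<Rightarrow> ('v, 'e) multigraph \<Rightarrow> bool" where
  "is_spanning_tree T G \<longleftrightarrow> is_subgraph T G \<and> is_tree T \<and> vertices T = vertices G"

definition leaves :: "('v, 'e) multigraph \<Rightarrow> 'v set" where
  "leaves T = {v \<in> vertices T. vertex_degree T v = 1}"

definition even_tree :: "('v, 'e) multigraph \<Rightarrow> bool" where
  "even_tree T \<longleftrightarrow>
     is_tree T \<and>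
     (\<forall>u\<in>leaves T. \<forall>v\<in>leaves T. u \<noteq> v \<longrightarrow>
        (\<exists>vs es. is_path_between T u vs es v \<and> even (length es)))"

end

theory Submission
  imports Defs
begin

text \<open>
  Grow an independent set \<open>B\<close> one vertex at a time, each new vertex having a common neighbour
  with the old ones, until \<open>B\<close> and its neighbours exhaust the graph. Then the edges meeting
  \<open>B\<close> form a connected spanning bipartite graph with classes \<open>B\<close> and \<open>A = V - B\<close>. Since \<open>B\<close>
  is independent, counting edges in the regular graph gives \<open>|N(S)| \<ge> |S|\<close> for every \<open>S \<subseteq> B\<close>, and
  equality for a nonempty \<open>S\<close> would make the graph bipartite; so \<open>|N(S)| > |S|\<close>. A minimal
  connected spanning subgraph of this bipartite graph that still has \<open>|N(S)| > |S|\<close> for all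
  nonempty \<open>S \<subseteq> B\<close> is a tree, by the uncrossing argument from Lovasz's theorem on
  forests in hypergraphs. Every vertex of \<open>B\<close> has at least two neighbours in it, so all leaves
  lie in \<open>A\<close>.
\<close>

section \<open>Neighbourhoods, surplus and connectivity of edge sets\<close>

definition adj :: "('e \<Rightarrow> 'v set) \<Rightarrow> 'e set \<Rightarrow> ('v \<times> 'v) set" where
  "adj en F = {(x, y). \<exists>e\<in>F. en e = {x, y}}"

definition nbrs :: "('e \<Rightarrow> 'v set) \<Rightarrow> 'e set \<Rightarrow> 'v set \<Rightarrow> 'v set" where
  "nbrs en F S = {a. \<exists>e\<in>F. \<exists>b\<in>S. en e = {a, b}}"

definition bipartition :: "('e \<Rightarrow> 'v set) \<Rightarrow> 'v set \<Rightarrow> 'v set \<Rightarrow> 'e set \<Rightarrow> bool" where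
  "bipartition en A B F \<longleftrightarrow> A \<inter> B = {} \<and> (\<forall>e\<in>F. \<exists>a\<in>A. \<exists>b\<in>B. en e = {a, b})"

text \<open>Hall's condition strengthened by one. Reading the neighbourhood of each vertex of
  \<open>B\<close> as a hyperedge, this is the hypothesis of Lovasz's theorem on forests in
  hypergraphs.\<close>

definition surplus :: "('e \<Rightarrow> 'v set) \<Rightarrow> 'v set \<Rightarrow> 'e set \<Rightarrow> bool" where
  "surplus en B F \<longleftrightarrow> (\<forall>S\<subseteq>B. S \<noteq> {} \<longrightarrow> card S < card (nbrs en F S))"

text \<open>Stated by reachability, so that the edge set can vary while \<open>V\<close> stays
  fixed, and simple paths are needed only when a tree is finally produced.\<close>

definition connects :: "('e \<Rightarrow> 'v set) \<Rightarrow> 'v set \<Rightarrow> 'e set \<Rightarrow> bool" where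
  "connects en V F \<longleftrightarrow> (\<forall>u\<in>V. \<forall>v\<in>V. (u, v) \<in> (adj en F)\<^sup>*)"

lemma bipartition_subset: "bipartition en A B F \<Longrightarrow> F' \<subseteq> F \<Longrightarrow> bipartition en A B F'"
  unfolding bipartition_def by blast

lemma bipartition_edgeE:
  assumes "bipartition en A B F" "e \<in> F" "b \<in> en e" "b \<in> B"
  obtains a where "a \<in> A" "en e = {a, b}"
  using assms unfolding bipartition_def by fastforce

lemma finite_nbrs:
  assumes "finite F" "bipartition en A B F"
  shows "finite (nbrs en F S)"
proof (rule finite_subset)
  show "nbrs en F S \<subseteq> (\<Union>e\<in>F. en e)" unfolding nbrs_def by blast
  have "finite (en e)" if "e \<in> F" for e
    using assms(2) that unfolding bipartition_def by fastforce
  then show "finite (\<Union>e\<in>F. en e)" using assms(1) by blast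
qed

lemma sym_adj: "sym (adj en F)"
  unfolding adj_def sym_def by (auto simp: insert_commute)

lemma rtrancl_adj_sym: "(x, y) \<in> (adj en F)\<^sup>* \<Longrightarrow> (y, x) \<in> (adj en F)\<^sup>*"
  using sym_rtrancl[OF sym_adj] by (metis symD)

lemma adj_mono: "F \<subseteq> F' \<Longrightarrow> adj en F \<subseteq> adj en F'"
  unfolding adj_def by blast

section \<open>Uncrossing two deficient sets\<close>

text \<open>
  The sets \<open>X\<close> and \<open>Y\<close> of neighbours of two deficient sets \<open>S1\<close> and \<open>S2\<close> are uncrossed.
  A third edge at \<open>b\<close> makes \<open>X \<inter> Y\<close> too large, even when \<open>S1 \<inter> S2 = {b}\<close>.
\<close>

lemma critical_edges_at_vertex:
  assumes fin: "finite F" "finite B" and bip: "bipartition en A B F"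
    and surp: "surplus en B F"
    and e: "e1 \<in> F" "e2 \<in> F" "e1 \<noteq> e2" "b \<in> en e1" "b \<in> en e2" "b \<in> B"
    and crit: "\<not> surplus en B (F - {e1})" "\<not> surplus en B (F - {e2})"
    and e3: "e3 \<in> F" "b \<in> en e3"
  shows "e3 = e1 \<or> e3 = e2"
proof (rule ccontr)
  assume "\<not> (e3 = e1 \<or> e3 = e2)"
  then have ne: "e3 \<noteq> e1" "e3 \<noteq> e2" by auto
  obtain S1 where S1: "S1 \<subseteq> B" "S1 \<noteq> {}" "card (nbrs en (F - {e1}) S1) \<le> card S1"
    using crit(1) unfolding surplus_def by (auto simp: not_less)
  obtain S2 where S2: "S2 \<subseteq> B" "S2 \<noteq> {}" "card (nbrs en (F - {e2}) S2) \<le> card S2"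
    using crit(2) unfolding surplus_def by (auto simp: not_less)
  define X where "X = nbrs en (F - {e1}) S1"
  define Y where "Y = nbrs en (F - {e2}) S2"
  obtain a1 where a1: "a1 \<in> A" "en e1 = {a1, b}" using bipartition_edgeE[OF bip e(1,4,6)] .
  obtain a2 where a2: "a2 \<in> A" "en e2 = {a2, b}" using bipartition_edgeE[OF bip e(2,5,6)] .
  obtain a3 where a3: "a3 \<in> A" "en e3 = {a3, b}" using bipartition_edgeE[OF bip e3 e(6)] .
  have disj: "A \<inter> B = {}" using bip unfolding bipartition_def by blast
  have only_b: "c = b" if "en e1 = {a, c} \<or> en e2 = {a, c}" "c \<in> B" for a c
    using that a1 a2 disj by (auto simp: doubleton_eq_iff)
  \<comment> \<open>The only end of \<open>e1\<close> in \<open>B\<close> is \<open>b\<close>, so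
    without \<open>b\<close> in \<open>S1\<close> the deletion of \<open>e1\<close> would leave the
    neighbours of \<open>S1\<close> unchanged, against the surplus.\<close>
  have b1: "b \<in> S1"
  proof (rule ccontr)
    assume "b \<notin> S1"
    then have "nbrs en (F - {e1}) S1 = nbrs en F S1"
      using only_b S1(1) unfolding nbrs_def by blast
    moreover have "card S1 < card (nbrs en F S1)"
      using surp S1(1,2) unfolding surplus_def by blast
    ultimately show False using S1(3) by simp
  qed
  have b2: "b \<in> S2"
  proof (rule ccontr)
    assume "b \<notin> S2"
    then have "nbrs en (F - {e2}) S2 = nbrs en F S2"
      using only_b S2(1) unfolding nbrs_def by blast
    moreover have "card S2 < card (nbrs en F S2)"
      using surp S2(1,2) unfolding surplus_def by blast
    ultimately show False using S2(3) by simp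
  qed
  have finXY: "finite X" "finite Y"
    unfolding X_def Y_def
    by (rule finite_nbrs[OF _ bipartition_subset[OF bip]]; use fin in auto)+
  have finS: "finite S1" "finite S2" using S1(1) S2(1) fin(2) finite_subset by auto
  \<comment> \<open>A neighbour lost from \<open>X\<close> by deleting \<open>e1\<close> reappears
    in \<open>Y\<close>: \<open>e1\<close> survives the deletion of \<open>e2\<close>, and
    \<open>b\<close> lies in \<open>S2\<close>. The same holds with the roles exchanged.\<close>
  have "nbrs en F (S1 \<union> S2) \<subseteq> X \<union> Y"
  proof
    fix a assume "a \<in> nbrs en F (S1 \<union> S2)"
    then obtain f c where f: "f \<in> F" "c \<in> S1 \<union> S2" "en f = {a, c}"
      unfolding nbrs_def by blast
    have "c \<in> B" using f(2) S1(1) S2(1) by blast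
    show "a \<in> X \<union> Y"
    proof (cases "f = e1 \<or> f = e2")
      case True
      then have "c = b" using only_b[of a c] f(3) \<open>c \<in> B\<close> by auto
      then show ?thesis using True f b1 b2 e(3) unfolding X_def Y_def nbrs_def by blast
    next
      case False
      then show ?thesis using f unfolding X_def Y_def nbrs_def by blast
    qed
  qed
  then have "card (nbrs en F (S1 \<union> S2)) \<le> card (X \<union> Y)"
    using finXY by (simp add: card_mono)
  moreover have "card (S1 \<union> S2) < card (nbrs en F (S1 \<union> S2))"
    using surp S1(1,2) S2(1) unfolding surplus_def by auto
  ultimately have un: "card (S1 \<union> S2) < card (X \<union> Y)" by linarith
  have "card X + card Y = card (X \<union> Y) + card (X \<inter> Y)"
    using card_Un_Int[OF finXY] .
  moreover have "card S1 + card S2 = card (S1 \<union> S2) + card (S1 \<inter> S2)"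
    using card_Un_Int[OF finS] .
  \<comment> \<open>Submodularity: the union has surplus at least 1, while \<open>S1\<close> and
    \<open>S2\<close> have none after their deletions, so the intersections show a deficit.\<close>
  ultimately have small: "card (X \<inter> Y) < card (S1 \<inter> S2)"
    using un S1(3) S2(3) unfolding X_def Y_def by linarith
  \<comment> \<open>Away from \<open>b\<close> neither deleted edge matters, so all neighbours of
    \<open>R\<close> lie in \<open>X\<close> and \<open>Y\<close>. A nonempty \<open>R\<close> then
    has at least \<open>card R + 1\<close> of them, which is too many. The surplus says nothing
    about an empty \<open>R\<close>; there the far end of \<open>e3\<close> does the work.\<close>
  define R where "R = S1 \<inter> S2 - {b}"
  have cR: "card (S1 \<inter> S2) = Suc (card R)"
    unfolding R_def using b1 b2 finS by (metis IntI card_Suc_Diff1 finite_Int)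
  show False
  proof (cases "R = {}")
    case True
    have "a3 \<in> X \<inter> Y"
      using a3 e3 ne b1 b2 unfolding X_def Y_def nbrs_def by blast
    then have "card (X \<inter> Y) > 0" using finXY by (auto simp: card_gt_0_iff)
    then show False using small cR True by simp
  next
    case False
    have "R \<subseteq> B" "R \<subseteq> S1" "R \<subseteq> S2" "b \<notin> R" using S1(1) unfolding R_def by auto
    have "nbrs en F R \<subseteq> X \<inter> Y"
    proof
      fix a assume "a \<in> nbrs en F R"
      then obtain f c where f: "f \<in> F" "c \<in> R" "en f = {a, c}" unfolding nbrs_def by blast
      then have "f \<noteq> e1" "f \<noteq> e2" using only_b[of a c] \<open>R \<subseteq> B\<close> \<open>b \<notin> R\<close> by auto
      then show "a \<in> X \<inter> Y"
        using f \<open>R \<subseteq> S1\<close> \<open>R \<subseteq> S2\<close> unfolding X_def Y_def nbrs_def by blast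
    qed
    then have "card (nbrs en F R) \<le> card (X \<inter> Y)" using finXY by (simp add: card_mono)
    moreover have "card R < card (nbrs en F R)"
      using surp \<open>R \<subseteq> B\<close> False unfolding surplus_def by blast
    ultimately show False using small cR by linarith
  qed
qed

section \<open>Acyclicity of minimal edge sets\<close>

lemma walk_segment_connected:
  assumes "is_walk G vs es" "i \<le> j" "j \<le> length es" "\<forall>m. i \<le> m \<and> m < j \<longrightarrow> es ! m \<in> F"
  shows "(vs ! i, vs ! j) \<in> (adj (ends G) F)\<^sup>*"
  using assms(2-)
proof (induction j rule: dec_induct)
  case base
  then show ?case by simp
next
  case (step n)
  have "es ! n \<in> F" using step by simp
  moreover have "ends G (es ! n) = {vs ! n, vs ! Suc n}"
    using assms(1) step unfolding is_walk_def by simp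
  ultimately have "(vs ! n, vs ! Suc n) \<in> adj (ends G) F" unfolding adj_def by blast
  moreover have "(vs ! i, vs ! n) \<in> (adj (ends G) F)\<^sup>*" using step by simp
  ultimately show ?case by (rule rtrancl.rtrancl_into_rtrancl[rotated])
qed

text \<open>The remaining edges of the cycle lead the other way round between the ends of the
  deleted edge, so every use of that edge can be replaced by a detour.\<close>

lemma connects_delete_cycle_edge:
  assumes cyc: "is_cycle G vs es" and F: "edges G = F" and conn: "connects (ends G) V F"
    and j: "j < length es"
  shows "connects (ends G) V (F - {es ! j})"
proof -
  let ?F = "F - {es ! j}"
  have walk: "is_walk G vs es" and dist: "distinct es" and "es \<noteq> []" and "hd vs = last vs"
    using cyc unfolding is_cycle_def by auto
  have len: "length vs = Suc (length es)" and es: "set es \<subseteq> F"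
    and endj: "ends G (es ! j) = {vs ! j, vs ! Suc j}"
    using walk j unfolding is_walk_def F by auto
  have "vs \<noteq> []" using len by auto
  have ends_eq: "vs ! 0 = vs ! length es"
    using \<open>hd vs = last vs\<close> len \<open>vs \<noteq> []\<close> by (simp add: hd_conv_nth last_conv_nth)
  have mem: "es ! m \<in> ?F" if "m < length es" "m \<noteq> j" for m
    using that es dist j by (auto simp: nth_eq_iff_index_eq)
  have "(vs ! Suc j, vs ! length es) \<in> (adj (ends G) ?F)\<^sup>*"
    using walk_segment_connected[OF walk, of "Suc j" "length es" ?F] j mem by auto
  moreover have "(vs ! 0, vs ! j) \<in> (adj (ends G) ?F)\<^sup>*"
    using walk_segment_connected[OF walk, of 0 j ?F] j mem by auto
  ultimately have rev_seg: "(vs ! Suc j, vs ! j) \<in> (adj (ends G) ?F)\<^sup>*"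
    using ends_eq by simp
  have "adj (ends G) F \<subseteq> (adj (ends G) ?F)\<^sup>*"
  proof (rule subrelI)
    fix x y assume "(x, y) \<in> adj (ends G) F"
    then obtain e where e: "e \<in> F" "ends G e = {x, y}" unfolding adj_def by blast
    show "(x, y) \<in> (adj (ends G) ?F)\<^sup>*"
    proof (cases "e = es ! j")
      case True
      then have "x = vs ! j \<and> y = vs ! Suc j \<or> x = vs ! Suc j \<and> y = vs ! j"
        using e(2) endj by (auto simp: doubleton_eq_iff)
      then show ?thesis using rev_seg rtrancl_adj_sym[OF rev_seg] by auto
    next
      case False
      then show ?thesis using e unfolding adj_def by blast
    qed
  qed
  then have "(adj (ends G) F)\<^sup>* \<subseteq> (adj (ends G) ?F)\<^sup>*" by (rule rtrancl_subset_rtrancl)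
  then show ?thesis using conn unfolding connects_def by blast
qed

text \<open>Deleting a cycle edge keeps connectivity, so by minimality it destroys the surplus.
  Hence each vertex of \<open>B\<close> on the cycle has no edges besides its two cycle edges, and
  all neighbours of these vertices lie on the cycle. The cycle alternates between the classes, so
  there are no more such neighbours than vertices of \<open>B\<close> on it, contradicting the
  surplus.\<close>

lemma minimal_surplus_acyclic:
  assumes fin: "finite (edges T)" "finite B"
    and bip: "bipartition (ends T) A B (edges T)"
    and surp: "surplus (ends T) B (edges T)"
    and conn: "connects (ends T) V (edges T)"
    and minimal: "\<And>e. e \<in> edges T \<Longrightarrow> connects (ends T) V (edges T - {e}) \<Longrightarrow>
      \<not> surplus (ends T) B (edges T - {e})"
  shows "\<not> is_cycle T vs es"
proof
  assume cyc: "is_cycle T vs es"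
  then have walk: "is_walk T vs es" and dist: "distinct es" "distinct (tl vs)"
    and "es \<noteq> []" and hl: "hd vs = last vs"
    unfolding is_cycle_def by auto
  have len: "length vs = Suc (length es)" and es: "set es \<subseteq> edges T"
    and ed: "\<And>i. i < length es \<Longrightarrow> ends T (es ! i) = {vs ! i, vs ! Suc i}"
    using walk unfolding is_walk_def by auto
  define k where "k = length es"
  have "vs \<noteq> []" using len by auto
  have wrap: "vs ! 0 = vs ! k"
    using hl len \<open>vs \<noteq> []\<close> by (simp add: hd_conv_nth last_conv_nth k_def)
  have "k > 0" using \<open>es \<noteq> []\<close> k_def by simp
  have disj: "A \<inter> B = {}" using bip unfolding bipartition_def by blast
  have esT: "es ! i \<in> edges T" if "i < k" for i using es that k_def by auto
  have alt: "vs ! i \<in> A \<and> vs ! Suc i \<in> B \<or> vs ! i \<in> B \<and> vs ! Suc i \<in> A" if i: "i < k" for i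
  proof -
    obtain a b where "a \<in> A" "b \<in> B" "ends T (es ! i) = {a, b}"
      using bip esT[OF i] unfolding bipartition_def by blast
    then show ?thesis using ed[of i] i k_def by (auto simp: doubleton_eq_iff)
  qed
  \<comment> \<open>A closed walk of length one would be a loop, which the bipartition excludes.
    Length two, a pair of parallel edges, remains possible.\<close>
  have "k \<noteq> 1" using alt[of 0] wrap disj by auto
  with \<open>k > 0\<close> have k2: "k \<ge> 2" by linarith
  have crit: "\<not> surplus (ends T) B (edges T - {es ! i})" if "i < k" for i
    using minimal[OF esT[OF that]] connects_delete_cycle_edge[OF cyc refl conn] that k_def
    by blast
  have set_vs: "\<exists>i<k. x = vs ! i" if x: "x \<in> set vs" for x
  proof -
    obtain i where "i < length vs" "x = vs ! i" using x by (auto simp: in_set_conv_nth)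
    show ?thesis
    proof (cases "i = k")
      case True
      then show ?thesis using wrap \<open>k > 0\<close> \<open>x = vs ! i\<close> by metis
    next
      case False
      then have "i < k" using \<open>i < length vs\<close> len k_def by simp
      then show ?thesis using \<open>x = vs ! i\<close> by blast
    qed
  qed
  have nth_vs: "vs ! i \<in> set vs" if "i \<le> k" for i using that len k_def by simp
  define S where "S = B \<inter> set vs"
  have "S \<noteq> {}"
  proof -
    have "vs ! 0 \<in> set vs" "vs ! Suc 0 \<in> set vs" using nth_vs k2 by auto
    then show ?thesis using alt[of 0] \<open>k > 0\<close> unfolding S_def by blast
  qed
  have "nbrs (ends T) (edges T) S \<subseteq> A \<inter> set vs"
  proof
    fix a assume "a \<in> nbrs (ends T) (edges T) S"
    then obtain f b where f: "f \<in> edges T" "b \<in> S" "ends T f = {a, b}"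
      unfolding nbrs_def by blast
    then have "b \<in> B" "b \<in> set vs" unfolding S_def by auto
    then obtain i where i: "i < k" "b = vs ! i" using set_vs by blast
    \<comment> \<open>The index of the cycle edge entering \<open>b\<close>, with wrap-around at
      position 0; it differs from \<open>i\<close> because \<open>k\<close> is at least 2.\<close>
    define j where "j = (if i = 0 then k - 1 else i - 1)"
    have j: "j < k" "vs ! Suc j = b" "j \<noteq> i"
      using i k2 wrap unfolding j_def by auto
    have "es ! i \<noteq> es ! j" using dist(1) i(1) j(1,3) k_def by (simp add: nth_eq_iff_index_eq)
    moreover have "b \<in> ends T (es ! i)" "b \<in> ends T (es ! j)"
      using ed i j k_def by auto
    ultimately have "f = es ! i \<or> f = es ! j"
      using critical_edges_at_vertex[OF fin bip surp esT[OF i(1)] esT[OF j(1)] _ _ _ \<open>b \<in> B\<close>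
          crit[OF i(1)] crit[OF j(1)] f(1)] f(3) by blast
    then have "a \<in> set vs"
    proof
      assume "f = es ! i"
      then have "a \<in> {vs ! i, vs ! Suc i}" using f(3) ed[of i] i(1) k_def by auto
      then show ?thesis using nth_vs[of i] nth_vs[of "Suc i"] i(1) by auto
    next
      assume "f = es ! j"
      then have "a \<in> {vs ! j, vs ! Suc j}" using f(3) ed[of j] j(1) k_def by auto
      then show ?thesis using nth_vs[of j] nth_vs[of "Suc j"] j(1) by auto
    qed
    moreover have "a \<in> A"
      using bipartition_edgeE[OF bip f(1) _ \<open>b \<in> B\<close>] f(3) \<open>b \<in> B\<close> disj
      by (metis disjoint_iff doubleton_eq_iff insertCI)
    ultimately show "a \<in> A \<inter> set vs" by blast
  qed
  then have "card (nbrs (ends T) (edges T) S) \<le> card (A \<inter> set vs)"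
    by (simp add: card_mono)
  also have "\<dots> \<le> card S"
  proof -
    from set_vs have "\<forall>x. \<exists>i. x \<in> set vs \<longrightarrow> i < k \<and> x = vs ! i" by blast
    then obtain g where g: "\<And>x. x \<in> set vs \<Longrightarrow> g x < k \<and> x = vs ! g x" by metis
    \<comment> \<open>Each vertex of \<open>A\<close> on the cycle is sent to its successor, which
      lies in \<open>B\<close>. Successors occupy positions 1 to \<open>k\<close>, exactly those of
      \<open>tl vs\<close>, whose entries are distinct.\<close>
    have suc_inj: "i = j" if "vs ! Suc i = vs ! Suc j" "i < k" "j < k" for i j
      using dist(2) that len k_def by (auto simp: nth_tl distinct_conv_nth)
    have "inj_on (\<lambda>x. vs ! Suc (g x)) (A \<inter> set vs)"
      by (rule inj_onI) (metis g suc_inj IntD2)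
    moreover have "(\<lambda>x. vs ! Suc (g x)) ` (A \<inter> set vs) \<subseteq> S"
    proof (rule image_subsetI)
      fix x assume x: "x \<in> A \<inter> set vs"
      then have gx: "g x < k" "x = vs ! g x" using g by auto
      then have "vs ! Suc (g x) \<in> B" using alt[of "g x"] x disj by auto
      moreover have "vs ! Suc (g x) \<in> set vs" using gx nth_vs by auto
      ultimately show "vs ! Suc (g x) \<in> S" unfolding S_def by blast
    qed
    moreover have "finite S" unfolding S_def by simp
    ultimately show ?thesis by (rule card_inj_on_le)
  qed
  finally have "card (nbrs (ends T) (edges T) S) \<le> card S" .
  moreover have "card S < card (nbrs (ends T) (edges T) S)"
    using surp \<open>S \<noteq> {}\<close> unfolding surplus_def S_def by blast
  ultimately show False by linarith
qed

section \<open>Paths, parity and reachability\<close>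

lemma path_if_reachable:
  assumes "(u, v) \<in> (adj (ends G) (edges G))\<^sup>*" "u \<in> vertices G" "loopless_graph G"
  shows "\<exists>vs es. is_path_between G u vs es v"
  using assms(1)
proof (induction rule: rtrancl_induct)
  case base
  have "is_path_between G u [u] [] u"
    using assms(2) unfolding is_path_between_def is_walk_def by simp
  then show ?case by blast
next
  case (step y z)
  then obtain vs es where p: "is_path_between G u vs es y" by blast
  obtain e where e: "e \<in> edges G" "ends G e = {y, z}" using step(2) unfolding adj_def by blast
  then have z: "z \<in> vertices G" using assms(3) unfolding loopless_graph_def by blast
  have w: "length vs = Suc (length es)" "set vs \<subseteq> vertices G" "set es \<subseteq> edges G"
    "\<And>i. i < length es \<Longrightarrow> ends G (es ! i) = {vs ! i, vs ! Suc i}"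
    "distinct vs" "hd vs = u" "last vs = y"
    using p unfolding is_path_between_def is_walk_def by auto
  have "vs \<noteq> []" using w(1) by auto
  show ?case
  \<comment> \<open>If \<open>z\<close> already lies on the path, the path is cut off there;
    otherwise it is extended by the new edge.\<close>
  proof (cases "z \<in> set vs")
    case True
    then obtain i where i: "i < length vs" "vs ! i = z" by (auto simp: in_set_conv_nth)
    have "set (take i es) \<subseteq> edges G" "set (take (Suc i) vs) \<subseteq> vertices G"
      using w(2,3) set_take_subset by fast+
    moreover have "last (take (Suc i) vs) = z" using i by (simp add: take_Suc_conv_app_nth)
    moreover have "hd (take (Suc i) vs) = u" using w(6) by simp
    ultimately have "is_path_between G u (take (Suc i) vs) (take i es) z"
      unfolding is_path_between_def is_walk_def using w(1,4,5) i(1) by simp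
    then show ?thesis by blast
  next
    case False
    have "y = vs ! length es" using w(1,7) \<open>vs \<noteq> []\<close> by (simp add: last_conv_nth)
    then have "is_path_between G u (vs @ [z]) (es @ [e]) z"
      unfolding is_path_between_def is_walk_def
      using w False \<open>vs \<noteq> []\<close> e z by (auto simp: nth_append less_Suc_eq)
    then show ?thesis by blast
  qed
qed

lemma bipartite_walk_parity:
  assumes walk: "is_walk G vs es" and bip: "bipartition (ends G) A B (edges G)"
    and "vs ! 0 \<in> A" "i \<le> length es"
  shows "if even i then vs ! i \<in> A else vs ! i \<in> B"
  using assms(4)
proof (induction i)
  case 0
  then show ?case using assms(3) by simp
next
  case (Suc i)
  have i: "i < length es" using Suc.prems by simp
  then have "es ! i \<in> edges G" "ends G (es ! i) = {vs ! i, vs ! Suc i}"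
    using walk unfolding is_walk_def by auto
  moreover then obtain a b where "a \<in> A" "b \<in> B" "ends G (es ! i) = {a, b}"
    using bip unfolding bipartition_def by blast
  moreover have "A \<inter> B = {}" using bip unfolding bipartition_def by blast
  ultimately show ?case using Suc i by (auto simp: doubleton_eq_iff)
qed

text \<open>Walks alternate between the classes, so a path with both ends in \<open>A\<close> has
  even length. It thus remains to build a spanning tree with no leaf in \<open>B\<close>.\<close>

lemma even_tree_if_leaves_subset:
  assumes "is_tree T" and bip: "bipartition (ends T) A B (edges T)" and "leaves T \<subseteq> A"
  shows "even_tree T"
  unfolding even_tree_def
proof (intro conjI ballI impI)
  show "is_tree T" by fact
  fix u v assume u: "u \<in> leaves T" and v: "v \<in> leaves T"
  then obtain vs es where p: "is_path_between T u vs es v"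
    using assms(1) unfolding is_tree_def connected_graph_def leaves_def by blast
  then have w: "is_walk T vs es" "hd vs = u" "last vs = v" and len: "length vs = Suc (length es)"
    unfolding is_path_between_def is_walk_def by auto
  then have "vs ! 0 = u" "vs ! length es = v"
    by (metis hd_conv_nth length_0_conv nat.distinct(1),
        metis last_conv_nth diff_Suc_1 length_0_conv nat.distinct(1))
  moreover have "u \<in> A" "v \<in> A" "A \<inter> B = {}"
    using u v assms(3) bip unfolding bipartition_def by auto
  ultimately have "even (length es)"
    using bipartite_walk_parity[OF w(1) bip, of "length es"] by (auto split: if_splits)
  then show "\<exists>vs es. is_path_between T u vs es v \<and> even (length es)" using p by blast
qed

lemma connects_if_connected_graph:
  assumes "connected_graph G"
  shows "connects (ends G) (vertices G) (edges G)"
  unfolding connects_def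
proof (intro ballI)
  fix u v assume "u \<in> vertices G" "v \<in> vertices G"
  then obtain vs es where p: "is_path_between G u vs es v"
    using assms unfolding connected_graph_def by blast
  then have w: "is_walk G vs es" "hd vs = u" "last vs = v"
    and len: "length vs = Suc (length es)" "set es \<subseteq> edges G"
    unfolding is_path_between_def is_walk_def by auto
  then have "vs ! 0 = u" "vs ! length es = v"
    by (metis hd_conv_nth length_0_conv nat.distinct(1),
        metis last_conv_nth diff_Suc_1 length_0_conv nat.distinct(1))
  then show "(u, v) \<in> (adj (ends G) (edges G))\<^sup>*"
    using walk_segment_connected[OF w(1), of 0 "length es" "edges G"] len
    by (simp add: subset_iff)
qed

lemma connects_closed_set:
  assumes "connects en V F" "W \<subseteq> V" "W \<noteq> {}"
    and closed: "\<And>x y. x \<in> W \<Longrightarrow> (x, y) \<in> adj en F \<Longrightarrow> y \<in> W"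
  shows "W = V"
proof -
  obtain w where "w \<in> W" using assms(3) by blast
  have "v \<in> W" if "(w, v) \<in> (adj en F)\<^sup>*" for v
    using that by (induction rule: rtrancl_induct) (use \<open>w \<in> W\<close> closed in auto)
  then show ?thesis using assms(1,2) \<open>w \<in> W\<close> unfolding connects_def by blast
qed

section \<open>The independent set\<close>

text \<open>A largest set satisfying an invariant replaces step-by-step growth: if \<open>B\<close>
  and its neighbours missed a vertex, connectivity would give an edge leaving them, and its outer
  end could be added to \<open>B\<close>.\<close>

lemma independent_set_connecting:
  assumes G: "loopless_graph G" and "connected_graph G"
  obtains B where "B \<subseteq> vertices G"
    "bipartition (ends G) (vertices G - B) B {e \<in> edges G. ends G e \<inter> B \<noteq> {}}"
    "connects (ends G) (vertices G) {e \<in> edges G. ends G e \<inter> B \<noteq> {}}"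
proof -
  let ?V = "vertices G" and ?E = "\<lambda>B. {e \<in> edges G. ends G e \<inter> B \<noteq> {}}"
  let ?N = "nbrs (ends G) (edges G)" and ?R = "\<lambda>B. (adj (ends G) (?E B))\<^sup>*"
  obtain v0 where v0: "v0 \<in> ?V" using assms(2) unfolding connected_graph_def by blast
  have fin: "finite ?V" and card2: "\<And>e. e \<in> edges G \<Longrightarrow> card (ends G e) = 2"
    and sub: "\<And>e. e \<in> edges G \<Longrightarrow> ends G e \<subseteq> ?V"
    using G unfolding loopless_graph_def by auto
  have conn: "connects (ends G) ?V (edges G)" using connects_if_connected_graph assms(2) .
  \<comment> \<open>The last clause roots reachability at the fixed \<open>v0\<close> and allows
    only edges meeting \<open>B\<close>. Once \<open>B\<close> and its neighbours are all vertices,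
    it yields the required connectivity.\<close>
  define P where "P B \<longleftrightarrow> v0 \<in> B \<and> B \<subseteq> ?V \<and> B \<inter> ?N B = {} \<and>
    (\<forall>w \<in> B \<union> ?N B. (v0, w) \<in> ?R B)" for B
  have "P {v0}"
  proof -
    have "v0 \<notin> ?N {v0}" using card2 unfolding nbrs_def by force
    moreover have "(v0, w) \<in> ?R {v0}" if "w \<in> ?N {v0}" for w
      using that unfolding nbrs_def adj_def by (blast intro: r_into_rtrancl)
    ultimately show ?thesis using v0 unfolding P_def by auto
  qed
  moreover have "card B \<le> card ?V" if "P B" for B
    using that fin unfolding P_def by (simp add: card_mono)
  ultimately obtain B where B: "P B" and max: "\<And>B'. P B' \<Longrightarrow> card B' \<le> card B"
    using ex_has_greatest_nat[of P "{v0}" card "Suc (card ?V)"] by (auto simp: less_Suc_eq_le)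
  have B': "v0 \<in> B" "B \<subseteq> ?V" "B \<inter> ?N B = {}" and reach: "\<And>w. w \<in> B \<union> ?N B \<Longrightarrow> (v0, w) \<in> ?R B"
    using B unfolding P_def by auto
  have NV: "?N X \<subseteq> ?V" for X using sub unfolding nbrs_def by blast
  have full: "B \<union> ?N B = ?V"
  proof (rule connects_closed_set[OF conn])
    show "B \<union> ?N B \<subseteq> ?V" using B'(2) NV by blast
    show "B \<union> ?N B \<noteq> {}" using B'(1) by blast
    fix x y assume x: "x \<in> B \<union> ?N B" and "(x, y) \<in> adj (ends G) (edges G)"
    then obtain e where e: "e \<in> edges G" "ends G e = {x, y}" unfolding adj_def by blast
    show "y \<in> B \<union> ?N B"
    proof (rule ccontr)
      \<comment> \<open>Since \<open>y\<close> is not a neighbour of \<open>B\<close>, adding it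
        keeps independence. The edge from \<open>x\<close> to \<open>y\<close> now meets the
        enlarged set, so \<open>y\<close> and then its neighbours become reachable.\<close>
      assume y: "y \<notin> B \<union> ?N B"
      have "y \<in> ?V" using sub e by blast
      have mono: "?R B \<subseteq> ?R (insert y B)" by (intro rtrancl_mono adj_mono) blast
      have Nins: "?N (insert y B) = ?N B \<union> ?N {y}" unfolding nbrs_def by blast
      have xy: "(v0, x) \<in> ?R (insert y B)" using reach[OF x] mono by blast
      moreover have "(x, y) \<in> adj (ends G) (?E (insert y B))" using e unfolding adj_def by blast
      ultimately have vy: "(v0, y) \<in> ?R (insert y B)" by (rule rtrancl.rtrancl_into_rtrancl)
      have "(v0, w) \<in> ?R (insert y B)" if w: "w \<in> ?N {y}" for w
      proof -
        have "(y, w) \<in> adj (ends G) (?E (insert y B))"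
          using w unfolding nbrs_def adj_def by (auto simp: insert_commute)
        then show ?thesis using vy by (rule rtrancl.rtrancl_into_rtrancl[rotated])
      qed
      moreover have "(v0, w) \<in> ?R (insert y B)" if "w \<in> B \<union> ?N B" for w
        using reach[OF that] mono by blast
      moreover have "insert y B \<inter> (?N B \<union> ?N {y}) = {}"
      proof -
        have "y \<notin> ?N {y}" using card2 unfolding nbrs_def by force
        moreover have "B \<inter> ?N {y} = {}"
          using y unfolding nbrs_def by (auto simp: insert_commute)
        ultimately show ?thesis using B'(3) y by blast
      qed
      ultimately have "P (insert y B)"
        unfolding P_def Nins using B'(1,2) vy \<open>y \<in> ?V\<close> by blast
      then have "card (insert y B) \<le> card B" by (rule max)
      moreover have "finite B" using B'(2) fin finite_subset by blast
      ultimately show False using y by simp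
    qed
  qed
  show thesis
  proof (rule that)
    show "B \<subseteq> ?V" by fact
    show "bipartition (ends G) (?V - B) B (?E B)"
      unfolding bipartition_def
    proof (intro conjI ballI)
      show "(?V - B) \<inter> B = {}" by blast
      fix e assume "e \<in> ?E B"
      then obtain b where e: "e \<in> edges G" "b \<in> ends G e" "b \<in> B" by blast
      obtain a where a: "ends G e = {a, b}"
        using card2[OF e(1)] e(2) by (metis card_2_iff doubleton_eq_iff insertE singletonD)
      then have "a \<in> ?N B" using e unfolding nbrs_def by blast
      then have "a \<in> ?V - B" using NV B'(3) by blast
      then show "\<exists>a\<in>?V - B. \<exists>b\<in>B. ends G e = {a, b}" using a e(3) by blast
    qed
    show "connects (ends G) ?V (?E B)"
      unfolding connects_def
    proof (intro ballI)
      fix u v assume "u \<in> ?V" "v \<in> ?V"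
      then have "(v0, u) \<in> ?R B" "(v0, v) \<in> ?R B" using reach full by auto
      then show "(u, v) \<in> ?R B" by (blast intro: rtrancl_trans[OF rtrancl_adj_sym])
    qed
  qed
qed

section \<open>Surplus from regularity\<close>

text \<open>Double counting: if \<open>S\<close> had at most \<open>card S\<close> neighbours, the
  \<open>card S * r\<close> edges at \<open>S\<close> would exhaust all edges at its neighbour set
  \<open>N\<close>. Then no edge leaves the union of \<open>S\<close> and \<open>N\<close>, which by
  connectivity is the whole graph, with \<open>S\<close> and \<open>N\<close> as its colour
  classes.\<close>

lemma regular_nonbipartite_surplus:
  assumes G: "loopless_graph G" and reg: "regular_graph r G"
    and nonbip: "\<not> bipartite_graph G" and "connected_graph G" and "B \<subseteq> vertices G"
    and bip: "bipartition (ends G) A B {e \<in> edges G. ends G e \<inter> B \<noteq> {}}"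
  shows "surplus (ends G) B {e \<in> edges G. ends G e \<inter> B \<noteq> {}}"
  unfolding surplus_def
proof (intro allI impI, rule ccontr)
  let ?F = "{e \<in> edges G. ends G e \<inter> B \<noteq> {}}"
  let ?V = "vertices G" and ?inc = "\<lambda>v. {e \<in> edges G. v \<in> ends G e}"
  fix S assume S: "S \<subseteq> B" "S \<noteq> {}"
    and "\<not> card S < card (nbrs (ends G) ?F S)"
  define N where "N = nbrs (ends G) ?F S"
  have le: "card N \<le> card S" using \<open>\<not> card S < _\<close> unfolding N_def by simp
  have finE: "finite (edges G)" and finV: "finite ?V"
    and sub: "\<And>e. e \<in> edges G \<Longrightarrow> ends G e \<subseteq> ?V"
    using G unfolding loopless_graph_def by auto
  have NV: "N \<subseteq> ?V" using sub unfolding N_def nbrs_def by blast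
  have disj: "A \<inter> B = {}" using bip unfolding bipartition_def by blast
  have finS: "finite S" and finN: "finite N"
    using S(1) assms(5) NV finV by (meson finite_subset subset_trans)+
  have edgeS: "\<exists>a\<in>N. ends G e = {a, s} \<and> a \<in> A" if "e \<in> ?inc s" "s \<in> S" for e s
  proof -
    have e: "e \<in> ?F" "s \<in> ends G e" "s \<in> B" using that S(1) by auto
    obtain a where a: "a \<in> A" "ends G e = {a, s}" using bipartition_edgeE[OF bip e] .
    then have "a \<in> N" unfolding N_def nbrs_def using e(1) \<open>s \<in> S\<close> by blast
    then show ?thesis using a by blast
  qed
  have deg: "card (?inc v) = r" if "v \<in> ?V" for v
    using reg that unfolding regular_graph_def vertex_degree_def by blast
  \<comment> \<open>An exact count, since every edge at \<open>S\<close> has its other end in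
    \<open>A\<close>.\<close>
  have "card (\<Union>s\<in>S. ?inc s) = (\<Sum>s\<in>S. card (?inc s))"
  proof (rule card_UN_disjoint[OF finS])
    show "\<forall>s\<in>S. finite (?inc s)" using finE by simp
    show "\<forall>s\<in>S. \<forall>t\<in>S. s \<noteq> t \<longrightarrow> ?inc s \<inter> ?inc t = {}"
    proof (intro ballI impI, rule ccontr)
      fix s t assume st: "s \<in> S" "t \<in> S" "s \<noteq> t" and "?inc s \<inter> ?inc t \<noteq> {}"
      then obtain e where e: "e \<in> ?inc s" "e \<in> ?inc t" by blast
      obtain a where "a \<in> A" "ends G e = {a, s}" using edgeS[OF e(1) st(1)] by blast
      moreover have "t \<in> B" "t \<in> ends G e" using st S e by auto
      ultimately show False using st(3) disj by auto
    qed
  qed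
  also have "\<dots> = card S * r" using deg S assms(5) by (simp add: subset_iff)
  finally have cS: "card (\<Union>s\<in>S. ?inc s) = card S * r" .
  \<comment> \<open>Only an upper bound, as edges of \<open>G\<close> inside \<open>N\<close> would
    be counted twice.\<close>
  have "card (\<Union>a\<in>N. ?inc a) \<le> (\<Sum>a\<in>N. card (?inc a))" by (rule card_UN_le[OF finN])
  also have "\<dots> = card N * r" using deg NV by (simp add: subset_iff)
  also have "\<dots> \<le> card S * r" using le by simp
  finally have card_le: "card (\<Union>a\<in>N. ?inc a) \<le> card (\<Union>s\<in>S. ?inc s)" using cS by simp
  have incl: "(\<Union>s\<in>S. ?inc s) \<subseteq> (\<Union>a\<in>N. ?inc a)"
  proof
    fix e assume "e \<in> (\<Union>s\<in>S. ?inc s)"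
    then obtain s where "s \<in> S" "e \<in> ?inc s" by blast
    then show "e \<in> (\<Union>a\<in>N. ?inc a)" using edgeS[of e s] by blast
  qed
  have "finite (\<Union>a\<in>N. ?inc a)" using finN finE by simp
  then have eq: "(\<Union>s\<in>S. ?inc s) = (\<Union>a\<in>N. ?inc a)"
    using incl card_le by (rule card_seteq)
  have joins: "\<exists>a\<in>N. \<exists>s\<in>S. ends G e = {a, s}"
    if e: "e \<in> edges G" "v \<in> ends G e" "v \<in> S \<union> N" for e v
  proof -
    have "e \<in> (\<Union>s\<in>S. ?inc s)"
    proof (cases "v \<in> S")
      case True
      then show ?thesis using e by blast
    next
      case False
      then have "e \<in> (\<Union>a\<in>N. ?inc a)" using e by blast
      then show ?thesis using eq by (rule ssubst[rotated])
    qed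
    then obtain s where "s \<in> S" "e \<in> ?inc s" by blast
    then show ?thesis using edgeS[of e s] by blast
  qed
  have full: "S \<union> N = ?V"
  proof (rule connects_closed_set[OF connects_if_connected_graph[OF assms(4)]])
    show "S \<union> N \<subseteq> ?V" "S \<union> N \<noteq> {}" using S assms(5) NV by auto
    fix x y assume "x \<in> S \<union> N" "(x, y) \<in> adj (ends G) (edges G)"
    then obtain e where "e \<in> edges G" "ends G e = {x, y}" "x \<in> S \<union> N" unfolding adj_def by blast
    then show "y \<in> S \<union> N" using joins[of e x] by (auto simp: doubleton_eq_iff)
  qed
  have "N \<inter> S = {}"
  proof -
    have "N \<subseteq> A"
    proof
      fix a assume "a \<in> N"
      then obtain e s where e: "e \<in> edges G" "s \<in> S" "ends G e = {a, s}"
        unfolding N_def nbrs_def by auto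
      then have "e \<in> ?inc s" by auto
      then obtain a' where "a' \<in> A" "ends G e = {a', s}" using edgeS[of e s] e(2) by blast
      then show "a \<in> A" using e(3) by (auto simp: doubleton_eq_iff)
    qed
    then show ?thesis using S(1) disj by blast
  qed
  moreover have "\<exists>a\<in>N. \<exists>s\<in>S. ends G e = {a, s}" if "e \<in> edges G" for e
  proof -
    have "ends G e \<noteq> {}" using G that unfolding loopless_graph_def by fastforce
    then obtain v where "v \<in> ends G e" by blast
    then show ?thesis using joins[of e v] sub[OF \<open>e \<in> edges G\<close>] full \<open>e \<in> edges G\<close> by blast
  qed
  ultimately have "bipartite_graph G"
    unfolding bipartite_graph_def using full by (metis Un_commute)
  then show False using nonbip by blast
qed

section \<open>Choice of the spanning tree\<close>

theorem theorem4:
  fixes G :: "('v, 'e) multigraph" and r :: nat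
  assumes "loopless_graph G"
    and "odd r"
    and "regular_graph r G"
    and "\<not> bipartite_graph G"
    and "connected_graph G"
  shows "\<exists>T. is_spanning_tree T G \<and> even_tree T"
proof -
  obtain B where BV: "B \<subseteq> vertices G" and
    bip0: "bipartition (ends G) (vertices G - B) B {e \<in> edges G. ends G e \<inter> B \<noteq> {}}" and
    conn0: "connects (ends G) (vertices G) {e \<in> edges G. ends G e \<inter> B \<noteq> {}}"
    using independent_set_connecting[OF assms(1,5)] .
  define F0 where "F0 = {e \<in> edges G. ends G e \<inter> B \<noteq> {}}"
  \<comment> \<open>The tree is an edge set of least cardinality with this property; deleting an
    edge without losing connectivity must then destroy the surplus.\<close>
  define P where "P F \<longleftrightarrow> F \<subseteq> F0 \<and> connects (ends G) (vertices G) F \<and> surplus (ends G) B F" for F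
  have "P F0"
    unfolding P_def F0_def
    using conn0 regular_nonbipartite_surplus[OF assms(1,3,4,5) BV bip0] by blast
  then obtain F where F: "P F" and least: "\<And>F'. P F' \<Longrightarrow> card F \<le> card F'"
    using ex_has_least_nat[of P F0 card] by blast
  define T where "T = \<lparr>vertices = vertices G, edges = F, ends = ends G\<rparr>"
  have T: "vertices T = vertices G" "edges T = F" "ends T = ends G" unfolding T_def by auto
  have FE: "F \<subseteq> edges G" using F unfolding P_def F0_def by blast
  have fin: "finite F" "finite B"
    using FE BV assms(1) unfolding loopless_graph_def by (auto intro: finite_subset)
  have bip: "bipartition (ends G) (vertices G - B) B F"
    using bipartition_subset[OF bip0] F unfolding P_def F0_def by blast
  have conn: "connects (ends G) (vertices G) F" and surp: "surplus (ends G) B F"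
    using F unfolding P_def by auto
  have loopless: "loopless_graph T"
    using assms(1) FE fin(1) unfolding loopless_graph_def T by blast
  have "\<not> surplus (ends G) B (F - {e})"
    if "e \<in> F" "connects (ends G) (vertices G) (F - {e})" for e
  proof
    assume "surplus (ends G) B (F - {e})"
    then have "P (F - {e})" using that F unfolding P_def by blast
    then have "card F \<le> card (F - {e})" by (rule least)
    then show False using that(1) fin(1) by (metis card_Diff1_less not_less)
  qed
  then have "\<not> is_cycle T vs es" for vs es
    using minimal_surplus_acyclic[of T B "vertices G - B" "vertices G"] fin bip surp conn
    unfolding T by blast
  moreover have "connected_graph T"
    unfolding connected_graph_def
  proof (intro conjI ballI)
    show "vertices T \<noteq> {}" using assms(5) unfolding connected_graph_def T by blast
    fix u v assume "u \<in> vertices T" "v \<in> vertices T"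
    then show "\<exists>vs es. is_path_between T u vs es v"
      using path_if_reachable[of u v T] conn loopless unfolding connects_def T by blast
  qed
  ultimately have tree: "is_tree T" using loopless unfolding is_tree_def by blast
  have "leaves T \<subseteq> vertices G - B"
  proof
    fix v assume "v \<in> leaves T"
    then have v: "v \<in> vertices G" "card {e \<in> F. v \<in> ends G e} = 1"
      unfolding leaves_def vertex_degree_def T by auto
    \<comment> \<open>The surplus of the singleton \<open>{v}\<close> gives a vertex of
      \<open>B\<close> at least two distinct neighbours, whereas a leaf has just one edge.\<close>
    have "v \<notin> B"
    proof
      assume "v \<in> B"
      then have "1 < card (nbrs (ends G) F {v})"
        using surp unfolding surplus_def by (metis One_nat_def card.empty card_insert_disjoint
            empty_iff empty_subsetI finite.emptyI insert_not_empty insert_subset)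
      obtain e where e: "{e \<in> F. v \<in> ends G e} = {e}"
        using v(2) by (auto simp: card_1_singleton_iff)
      obtain a where a: "ends G e = {a, v}"
        using bipartition_edgeE[OF bip _ _ \<open>v \<in> B\<close>, of e] e by blast
      have "nbrs (ends G) F {v} \<subseteq> {a}"
      proof
        fix x assume "x \<in> nbrs (ends G) F {v}"
        then obtain f where f: "f \<in> F" "ends G f = {x, v}" unfolding nbrs_def by blast
        then have "f = e" using e by blast
        then show "x \<in> {a}" using f a by (auto simp: doubleton_eq_iff)
      qed
      then have "card (nbrs (ends G) F {v}) \<le> 1" using card_mono[of "{a}"] by auto
      then show False using \<open>1 < card _\<close> by linarith
    qed
    then show "v \<in> vertices G - B" using v(1) by blast
  qed
  then have "even_tree T"
    using even_tree_if_leaves_subset[OF tree, of "vertices G - B" B] bip unfolding T by blast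
  moreover have "is_spanning_tree T G"
    using tree loopless FE unfolding is_spanning_tree_def is_subgraph_def T by blast
  ultimately show ?thesis by blast
qed

end
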